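(* Let $N\ge 1$, let $\omega\in\mathbb{C}$ with $|\omega|=1$, and let $a_0,\dots,a_{N-1}\in\mathbb{C}$ with $|a_n|<1$ for $n=0,\dots,N-1$, and $a_N=\omega$, $a_{-1}=-1$. Let $\Phi_0,\dots,\Phi_{N+1}$ be the associated monic polynomials orthogonal on the unit circle (OPUC), $z_0,\dots,z_N$ the (distinct, unimodular) roots of $\Phi_{N+1}$, and $h_N=\prod_{k=0}^{N-1}(1-|a_k|^2)$. Then the OPUC are persymmetric, i.e. $a_n=-\omega\,\overline{a_{N-1-n}}$ for $n=0,1,\dots,N$, if and only if $$|\Phi_N(z_s)|=\sqrt{h_N},\qquad s=0,1,\dots,N.$$
   Context: The monic polynomials are defined by $\Phi_0=1$ and the Szegő recurrence $\Phi_{n+1}(z)=z\Phi_n(z)-\overline{a_n}\,\Phi_n^*(z)$ for $n=0,\dots,N$, where $\Phi_n^*(z)=z^n\overline{\Phi}_n(1/z)$ and $\overline{\Phi}_n$ denotes the polynomial obtained from $\Phi_n$ by conjugating its coefficients. Since $|a_N|=1$, the polynomial $\Phi_{N+1}$ has $N+1$ distinct roots $z_0,\dots,z_N$ on the unit circle. *)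

theory Defs
  imports Complex_Main "HOL-Computational_Algebra.Polynomial"
begin

text \<open>
  The Verblunsky coefficients are indexed by \<open>int\<close>, so that \<open>a (- 1)\<close> makes sense.
  Since \<open>\<Phi>\<^sub>n\<close> has degree exactly \<open>n\<close> (\<open>degree_opuc\<close> below), reversing the conjugated
  coefficients with \<^const>\<open>reflect_poly\<close> yields \<open>\<Phi>\<^sub>n\<^sup>*(z) = z\<^sup>n \<Phi>'\<^sub>n(1/z)\<close>, where
  \<open>\<Phi>'\<^sub>n\<close> has the conjugated coefficients of \<open>\<Phi>\<^sub>n\<close>; see
  \<open>poly_opuc_star\<close>.
\<close>

definition conj_reversed :: "complex poly \<Rightarrow> complex poly" where
  "conj_reversed p = reflect_poly (map_poly cnj p)"

fun opuc :: "(int \<Rightarrow> complex) \<Rightarrow> nat \<Rightarrow> complex poly" where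
  "opuc a 0 = 1"
| "opuc a (Suc n) =
     [:0, 1:] * opuc a n - smult (cnj (a (int n))) (conj_reversed (opuc a n))"

lemma degree_opuc: "degree (opuc a n) = n"
  and lead_coeff_opuc: "lead_coeff (opuc a n) = 1"
proof -
  have "degree (opuc a n) = n \<and> coeff (opuc a n) n = 1"
  proof (induction n)
    case (Suc n)
    have star: "degree (conj_reversed (opuc a n)) \<le> n"
      using Suc degree_reflect_poly_le[of "map_poly cnj (opuc a n)"]
      by (simp add: conj_reversed_def degree_map_poly)
    then have "coeff (opuc a (Suc n)) (Suc n) = 1"
      using Suc by (simp add: coeff_eq_0)
    moreover have "degree (opuc a (Suc n)) \<le> Suc n"
      unfolding opuc.simps
      by (rule degree_diff_le) (use Suc star degree_pCons_le[of 0 "opuc a n"] in auto)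
    ultimately show ?case
      by (metis le_antisym le_degree zero_neq_one)
  qed simp
  then show "degree (opuc a n) = n" "lead_coeff (opuc a n) = 1"
    by auto
qed

lemma poly_opuc_star:
  assumes "z \<noteq> 0"
  shows "poly (conj_reversed (opuc a n)) z = z ^ n * poly (map_poly cnj (opuc a n)) (1 / z)"
proof -
  have "degree (map_poly cnj (opuc a n)) = n"
    by (subst degree_map_poly) (auto simp: degree_opuc)
  with assms show ?thesis
    by (simp add: conj_reversed_def poly_reflect_poly_nz inverse_eq_divide)
qed

end

theory Submission
  imports Defs
begin

text \<open>
  Let \<open>b\<^sub>k = - \<omega> cnj a\<^sub>N\<^sub>-\<^sub>1\<^sub>-\<^sub>k\<close> and let \<open>\<Phi>\<^sup>b\<close> be the polynomials with these reversed coefficients.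
  At a root \<open>\<zeta>\<close> of \<open>\<Phi>\<^sub>N\<^sub>+\<^sub>1\<close>, running the recurrence of \<open>\<Phi>\<close> backwards is the same as running that of
  \<open>\<Phi>\<^sup>b\<close> forwards, which gives \<open>\<zeta> \<Phi>\<^sup>b\<^sub>N(\<zeta>) \<Phi>\<^sub>N(\<zeta>) = cnj \<omega> \<zeta>\<^sup>N h\<^sub>N\<close>. Since \<open>|\<zeta>| = 1\<close>, the relation
  \<open>\<zeta> \<Phi>\<^sub>N(\<zeta>) = cnj \<omega> \<Phi>\<^sub>N\<^sup>*(\<zeta>)\<close> also gives \<open>\<zeta> \<Phi>\<^sub>N(\<zeta>)\<^sup>2 = cnj \<omega> \<zeta>\<^sup>N |\<Phi>\<^sub>N(\<zeta>)|\<^sup>2\<close>. Hence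
  \<open>|\<Phi>\<^sub>N(\<zeta>)|\<^sup>2 = h\<^sub>N\<close> if and only if \<open>\<Phi>\<^sub>N(\<zeta>) = \<Phi>\<^sup>b\<^sub>N(\<zeta>)\<close>. The \<open>N + 1\<close> roots being distinct, this
  happens at all of them if and only if \<open>\<Phi>\<^sub>N = \<Phi>\<^sup>b\<^sub>N\<close>, that is, if and only if \<open>a\<close> and \<open>b\<close> agree.
\<close>

section \<open>Reversed polynomials and their Szego recurrence\<close>

lemma coeff_conj_reversed_opuc:
  "coeff (conj_reversed (opuc a n)) i = (if i \<le> n then cnj (coeff (opuc a n) (n - i)) else 0)"
proof -
  have "degree (map_poly cnj (opuc a n)) = n"
    by (subst degree_map_poly) (auto simp: degree_opuc)
  then show ?thesis
    by (auto simp: conj_reversed_def coeff_reflect_poly coeff_map_poly)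
qed

lemma conj_reversed_opuc_0: "conj_reversed (opuc a 0) = 1"
  by (simp add: conj_reversed_def map_poly_1)

text \<open>Reversal at degree \<open>Suc n\<close> swaps \<open>[:0, 1:] * opuc a n\<close> with
  \<open>conj_reversed (opuc a n)\<close>; the top coefficient matches because
  \<open>opuc a n\<close> is monic.\<close>

lemma conj_reversed_opuc_Suc:
  "conj_reversed (opuc a (Suc n)) =
     conj_reversed (opuc a n) - smult (a (int n)) ([:0, 1:] * opuc a n)"
proof (rule poly_eqI)
  fix i
  have "coeff (opuc a n) n = 1" "coeff (opuc a n) (Suc n) = 0"
    using lead_coeff_opuc[of a n] by (simp_all add: degree_opuc coeff_eq_0)
  then show "coeff (conj_reversed (opuc a (Suc n))) i =
      coeff (conj_reversed (opuc a n) - smult (a (int n)) ([:0, 1:] * opuc a n)) i"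
    unfolding coeff_diff coeff_smult coeff_conj_reversed_opuc
    by (cases "i = Suc n")
      (auto simp: coeff_conj_reversed_opuc coeff_pCons Suc_diff_le coeff_eq_0 degree_opuc
        split: nat.splits)
qed

lemma poly_opuc_Suc:
  "poly (opuc a (Suc n)) x =
     x * poly (opuc a n) x - cnj (a (int n)) * poly (conj_reversed (opuc a n)) x"
  by simp

lemma poly_conj_reversed_opuc_Suc:
  "poly (conj_reversed (opuc a (Suc n))) x =
     poly (conj_reversed (opuc a n)) x - a (int n) * (x * poly (opuc a n) x)"
  unfolding conj_reversed_opuc_Suc by simp

text \<open>On the unit circle \<open>1 / \<zeta>\<close> is \<open>cnj \<zeta>\<close>, so
  conjugating the coefficients there amounts to conjugating the value.\<close>

lemma poly_conj_reversed_opuc_unit: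
  assumes "cmod \<zeta> = 1"
  shows "poly (conj_reversed (opuc a n)) \<zeta> = \<zeta> ^ n * cnj (poly (opuc a n) \<zeta>)"
proof (induction n)
  case 0
  show ?case by (simp only: conj_reversed_opuc_0) simp
next
  case (Suc n)
  have u: "\<zeta> * cnj \<zeta> = 1" "\<zeta> ^ n * cnj \<zeta> ^ n = 1"
    using assms by (simp_all add: complex_norm_square[symmetric] flip: power_mult_distrib)
  have "\<zeta> ^ Suc n * cnj (poly (opuc a (Suc n)) \<zeta>) =
      \<zeta> ^ n * (\<zeta> * cnj \<zeta>) * cnj (poly (opuc a n) \<zeta>) -
      a (int n) * \<zeta> * (\<zeta> ^ n * cnj \<zeta> ^ n) * poly (opuc a n) \<zeta>"
    unfolding poly_opuc_Suc Suc.IH by (simp add: algebra_simps)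
  then show ?case
    unfolding poly_conj_reversed_opuc_Suc Suc.IH u by simp
qed

section \<open>Coefficients and polynomials determine each other\<close>

lemma opuc_cong:
  assumes "\<And>k. k < n \<Longrightarrow> a (int k) = b (int k)"
  shows "opuc a n = opuc b n"
  using assms by (induction n) auto

text \<open>Inverse Szego step: combining the two recurrences eliminates the reversed polynomial of
  index \<open>n\<close>, and the factor is the determinant of the step.\<close>

lemma opuc_Suc_inverse:
  "opuc a (Suc n) + smult (cnj (a (int n))) (conj_reversed (opuc a (Suc n))) =
     smult (1 - a (int n) * cnj (a (int n))) ([:0, 1:] * opuc a n)"
  unfolding conj_reversed_opuc_Suc unfolding opuc.simps
  by (simp add: fun_eq_iff algebra_simps flip: poly_eq_poly_eq_iff)

lemma one_minus_mult_cnj: "1 - x * cnj x = of_real (1 - (cmod x)\<^sup>2)"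
  unfolding of_real_diff complex_norm_square by simp

text \<open>The constant term reveals the last coefficient; the inverse step, whose factor is
  nonzero by the bound on \<open>a\<close>, then lowers the degree.\<close>

lemma opuc_inj:
  assumes "opuc a n = opuc b n"
    and "\<And>k. k < n \<Longrightarrow> cmod (a (int k)) < 1"
    and "k < n"
  shows "a (int k) = b (int k)"
  using assms
proof (induction n)
  case (Suc n)
  have "coeff (opuc c (Suc n)) 0 = - cnj (c (int n))" for c
    using lead_coeff_opuc[of c n]
    by (simp add: coeff_conj_reversed_opuc degree_opuc)
  then have n: "a (int n) = b (int n)"
    using Suc.prems(1) by (metis complex_cnj_cancel_iff neg_equal_iff_equal)
  have "1 - a (int n) * cnj (a (int n)) \<noteq> 0"
    using Suc.prems(2)[of n] abs_square_less_1[of "cmod (a (int n))"]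
    unfolding one_minus_mult_cnj of_real_eq_0_iff by simp
  then have "opuc a n = opuc b n"
    using opuc_Suc_inverse[of a n] opuc_Suc_inverse[of b n] n Suc.prems(1)
    by (metis mult_cancel_left pCons_eq_0_iff smult_cancel zero_neq_one)
  then show ?case
    using Suc n by (cases "k = n") auto
qed simp

section \<open>Location and simplicity of the zeros\<close>

text \<open>For \<open>X\<close> and \<open>Y\<close> the values of
  \<open>[:0, 1:] * opuc a n\<close> and its reversed partner, a Szego step scales this indefinite
  form by a factor that is positive if |\<alpha>| < 1, so its sign persists.\<close>

lemma norm_diff_szego_step:
  fixes X Y \<alpha> :: complex
  shows "(cmod (Y - \<alpha> * X))\<^sup>2 - (cmod (X - cnj \<alpha> * Y))\<^sup>2 =
    (1 - (cmod \<alpha>)\<^sup>2) * ((cmod Y)\<^sup>2 - (cmod X)\<^sup>2)"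
  by (simp add: cmod_power2) (simp add: algebra_simps power2_eq_square)

lemma norm_mult_opuc_less:
  assumes "cmod x < 1" "\<And>k. k < n \<Longrightarrow> cmod (a (int k)) < 1"
  shows "cmod (x * poly (opuc a n) x) < cmod (poly (conj_reversed (opuc a n)) x)"
  using assms(2)
proof (induction n)
  case 0
  show ?case using assms by (simp only: conj_reversed_opuc_0) simp
next
  case (Suc n)
  let ?X = "x * poly (opuc a n) x" and ?Y = "poly (conj_reversed (opuc a n)) x"
  have "(cmod ?X)\<^sup>2 < (cmod ?Y)\<^sup>2" "(cmod (a (int n)))\<^sup>2 < 1"
    using Suc by (auto intro!: power_strict_mono simp: abs_square_less_1)
  then have "0 < (1 - (cmod (a (int n)))\<^sup>2) * ((cmod ?Y)\<^sup>2 - (cmod ?X)\<^sup>2)"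
    by simp
  then have "(cmod (poly (opuc a (Suc n)) x))\<^sup>2 < (cmod (poly (conj_reversed (opuc a (Suc n))) x))\<^sup>2"
    unfolding norm_diff_szego_step[symmetric] poly_opuc_Suc poly_conj_reversed_opuc_Suc by simp
  then have "cmod (poly (opuc a (Suc n)) x) < cmod (poly (conj_reversed (opuc a (Suc n))) x)"
    by (rule power2_less_imp_less) simp
  \<comment> \<open>The next step needs an extra factor \<open>x\<close>, which inside the disc only
    helps.\<close>
  moreover have "cmod (x * poly (opuc a (Suc n)) x) \<le> cmod (poly (opuc a (Suc n)) x)"
    unfolding norm_mult using assms(1) by (intro mult_left_le_one_le) auto
  ultimately show ?case by linarith
qed

lemma norm_mult_opuc_greater:
  assumes "cmod x > 1" "\<And>k. k < n \<Longrightarrow> cmod (a (int k)) < 1"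
  shows "cmod (poly (conj_reversed (opuc a n)) x) < cmod (x * poly (opuc a n) x)"
  using assms(2)
proof (induction n)
  case 0
  show ?case using assms by (simp only: conj_reversed_opuc_0) simp
next
  case (Suc n)
  let ?X = "x * poly (opuc a n) x" and ?Y = "poly (conj_reversed (opuc a n)) x"
  have "(cmod ?Y)\<^sup>2 < (cmod ?X)\<^sup>2" "(cmod (a (int n)))\<^sup>2 < 1"
    using Suc by (auto intro!: power_strict_mono simp: abs_square_less_1)
  then have "(1 - (cmod (a (int n)))\<^sup>2) * ((cmod ?Y)\<^sup>2 - (cmod ?X)\<^sup>2) < 0"
    by (simp add: mult_pos_neg)
  then have "(cmod (poly (conj_reversed (opuc a (Suc n))) x))\<^sup>2 < (cmod (poly (opuc a (Suc n)) x))\<^sup>2"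
    unfolding norm_diff_szego_step[symmetric] poly_opuc_Suc poly_conj_reversed_opuc_Suc by simp
  then have "cmod (poly (conj_reversed (opuc a (Suc n))) x) < cmod (poly (opuc a (Suc n)) x)"
    by (rule power2_less_imp_less) simp
  moreover have "1 * cmod (poly (opuc a (Suc n)) x) \<le> cmod (x * poly (opuc a (Suc n)) x)"
    unfolding norm_mult using assms(1) by (intro mult_right_mono) auto
  ultimately show ?case by linarith
qed

text \<open>At a root the unimodular last coefficient forces equal moduli, which the two strict
  inequalities exclude off the circle.\<close>

lemma norm_root_opuc_Suc:
  assumes "poly (opuc a (Suc n)) \<zeta> = 0" "cmod (a (int n)) = 1"
    and "\<And>k. k < n \<Longrightarrow> cmod (a (int k)) < 1"
  shows "cmod \<zeta> = 1"
proof -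
  have "\<zeta> * poly (opuc a n) \<zeta> = cnj (a (int n)) * poly (conj_reversed (opuc a n)) \<zeta>"
    using assms(1) unfolding poly_opuc_Suc by simp
  then have "cmod (\<zeta> * poly (opuc a n) \<zeta>) = cmod (poly (conj_reversed (opuc a n)) \<zeta>)"
    using assms(2) by (metis complex_mod_cnj mult_1 norm_mult)
  then show ?thesis
    using norm_mult_opuc_less[of \<zeta> n a] norm_mult_opuc_greater[of \<zeta> n a] assms(3)
    by (metis less_irrefl linorder_neqE)
qed

text \<open>A form of the Christoffel--Darboux formula; up to normalisation \<open>K\<close> is the kernel.\<close>

lemma christoffel_darboux:
  assumes "cmod \<zeta> = 1" "\<And>k. k < n \<Longrightarrow> cmod (a (int k)) < 1"
  shows "\<exists>K k. smult (cnj (poly (conj_reversed (opuc a n)) \<zeta>)) (conj_reversed (opuc a n)) -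
           smult (cnj (\<zeta> * poly (opuc a n) \<zeta>)) ([:0, 1:] * opuc a n) = [:1, - cnj \<zeta>:] * K \<and>
         poly K \<zeta> = complex_of_real k \<and> k > 0"
  using assms(2)
proof (induction n)
  case 0
  show ?case
    by (rule exI[of _ 1], rule exI[of _ 1]) (simp only: conj_reversed_opuc_0, simp)
next
  case (Suc n)
  let ?P = "opuc a n" and ?Q = "conj_reversed (opuc a n)"
  let ?P' = "opuc a (Suc n)" and ?Q' = "conj_reversed (opuc a (Suc n))"
  define r where "r = 1 - (cmod (a (int n)))\<^sup>2"
  have r: "r > 0" using Suc.prems[of n] by (simp add: r_def abs_square_less_1)
  have r': "complex_of_real r = 1 - a (int n) * cnj (a (int n))"
    by (simp add: r_def one_minus_mult_cnj)
  obtain K k where K: "smult (cnj (poly ?Q \<zeta>)) ?Q - smult (cnj (\<zeta> * poly ?P \<zeta>)) ([:0, 1:] * ?P)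
      = [:1, - cnj \<zeta>:] * K" "poly K \<zeta> = complex_of_real k" "k > 0"
    using Suc by auto
  \<comment> \<open>The added term accounts for inserting the factor
    \<open>[:0, cnj \<zeta>:]\<close> in front of the product of the new \<open>?P'\<close>; at
    \<zeta> it contributes a squared modulus, so positivity persists.\<close>
  define K' where "K' = smult (complex_of_real r) K + smult (cnj (poly ?P' \<zeta>)) ?P'"
  \<comment> \<open>This is the polarised form of \<open>norm_diff_szego_step\<close>.\<close>
  have "smult (cnj (poly ?Q' \<zeta>)) ?Q' - smult (cnj (poly ?P' \<zeta>)) ?P' =
      smult (complex_of_real r) ([:1, - cnj \<zeta>:] * K)"
    unfolding K(1)[symmetric] r' poly_opuc_Suc poly_conj_reversed_opuc_Suc
    unfolding conj_reversed_opuc_Suc unfolding opuc.simps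
    by (simp add: fun_eq_iff algebra_simps flip: poly_eq_poly_eq_iff)
  then have "smult (cnj (poly ?Q' \<zeta>)) ?Q' - smult (cnj (\<zeta> * poly ?P' \<zeta>)) ([:0, 1:] * ?P')
      = [:1, - cnj \<zeta>:] * K'"
    unfolding K'_def by (simp add: algebra_simps smult_add_right del: opuc.simps)
  moreover have "poly K' \<zeta> = complex_of_real (r * k + (cmod (poly ?P' \<zeta>))\<^sup>2)"
    unfolding K'_def of_real_add of_real_mult complex_norm_square K(2)[symmetric]
    by (simp add: mult.commute[of "cnj _"] del: opuc.simps)
  moreover have "r * k + (cmod (poly ?P' \<zeta>))\<^sup>2 > 0"
    using r K(3) by (simp add: add_pos_nonneg)
  ultimately show ?case by blast
qed

text \<open>At a root the Christoffel-Darboux expression is a multiple of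
  \<open>opuc a (Suc n)\<close>. Cancelling the linear factor makes \<open>poly q \<zeta>\<close> a
  divisor of a nonzero multiple of \<open>poly K \<zeta>\<close>, which is positive.\<close>

lemma simple_root_opuc_Suc:
  assumes "cmod (a (int n)) = 1" "\<And>k. k < n \<Longrightarrow> cmod (a (int k)) < 1"
    and "opuc a (Suc n) = [:- \<zeta>, 1:] * q"
  shows "poly q \<zeta> \<noteq> 0"
proof
  assume q: "poly q \<zeta> = 0"
  let ?P = "opuc a n" and ?Q = "conj_reversed (opuc a n)"
  let ?w = "a (int n)"
  have root: "poly (opuc a (Suc n)) \<zeta> = 0" unfolding assms(3) by simp
  have \<zeta>: "cmod \<zeta> = 1" using norm_root_opuc_Suc[OF root assms(1,2)] .
  have "\<zeta> * poly ?P \<zeta> = cnj ?w * poly ?Q \<zeta>"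
    using root unfolding poly_opuc_Suc by simp
  then have c: "cnj (\<zeta> * poly ?P \<zeta>) = ?w * cnj (poly ?Q \<zeta>)"
    by (metis complex_cnj_cnj complex_cnj_mult)
  have w: "?w * cnj ?w = 1" using assms(1) by (simp add: complex_norm_square[symmetric])
  obtain K k where K: "smult (cnj (poly ?Q \<zeta>)) ?Q - smult (cnj (\<zeta> * poly ?P \<zeta>)) ([:0, 1:] * ?P)
      = [:1, - cnj \<zeta>:] * K" "poly K \<zeta> = complex_of_real k" "k > 0"
    using christoffel_darboux[of \<zeta> n a] \<zeta> assms(2) by blast
  \<comment> \<open>With \<open>d\<close> factored out, the two terms form the last Szego step up to
    sign.\<close>
  define d where "d = ?w * cnj (poly ?Q \<zeta>)"
  have Q: "cnj (poly ?Q \<zeta>) = d * cnj ?w" using w by (simp add: d_def)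
  have "[:1, - cnj \<zeta>:] * K = smult (- d) (opuc a (Suc n))"
    unfolding K(1)[symmetric] c d_def[symmetric] unfolding Q by (simp add: smult_diff_right)
  moreover have "[:1, - cnj \<zeta>:] = smult (- cnj \<zeta>) [:- \<zeta>, 1:]"
    using \<zeta> by (simp add: complex_norm_square[symmetric] mult.commute[of "cnj _"])
  ultimately have "[:- \<zeta>, 1:] * smult (- cnj \<zeta>) K = [:- \<zeta>, 1:] * smult (- d) q"
    unfolding assms(3) by (metis mult_smult_left mult_smult_right)
  then have "smult (- cnj \<zeta>) K = smult (- d) q"
    by (simp only: mult_cancel_left) simp
  then have "poly (smult (- cnj \<zeta>) K) \<zeta> = poly (smult (- d) q) \<zeta>" by simp
  then show False using q K(2,3) \<zeta> by auto
qed

text \<open>The root relation is the case \<open>k = 0\<close>. Each step for \<open>b\<close> is an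
  inverse step for \<open>a\<close> with the two components exchanged, so both identities must be
  carried together; \<open>h k\<close> collects the determinants.\<close>

lemma reversed_opuc_at_root:
  fixes a b :: "int \<Rightarrow> complex"
  assumes w: "\<omega> * cnj \<omega> = 1"
    and b: "\<And>k. k < N \<Longrightarrow> b (int k) = - \<omega> * cnj (a (int (N - Suc k)))"
    and root: "\<zeta> * poly (opuc a N) \<zeta> = cnj \<omega> * poly (conj_reversed (opuc a N)) \<zeta>"
    and "k \<le> N"
  defines "h \<equiv> \<lambda>k. \<Prod>j<k. complex_of_real (1 - (cmod (a (int (N - Suc j))))\<^sup>2)"
  shows "\<zeta> * poly (opuc b k) \<zeta> * poly (opuc a N) \<zeta> =
           cnj \<omega> * \<zeta> ^ k * h k * poly (conj_reversed (opuc a (N - k))) \<zeta> \<and>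
         poly (conj_reversed (opuc b k)) \<zeta> * poly (opuc a N) \<zeta> =
           \<zeta> ^ k * h k * poly (opuc a (N - k)) \<zeta>"
  using \<open>k \<le> N\<close>
proof (induction k)
  case 0
  show ?case
    using root by (simp only: conj_reversed_opuc_0) (simp add: h_def)
next
  case (Suc k)
  define n where "n = N - Suc k"
  have Nk: "N - k = Suc n" using Suc.prems by (simp add: n_def)
  define \<alpha> where "\<alpha> = a (int n)"
  define p where "p = poly (opuc a n) \<zeta>"
  define q where "q = poly (conj_reversed (opuc a n)) \<zeta>"
  define u where "u = poly (opuc b k) \<zeta>"
  define v where "v = poly (conj_reversed (opuc b k)) \<zeta>"
  define \<phi> where "\<phi> = poly (opuc a N) \<zeta>"
  have bk: "b (int k) = - \<omega> * cnj \<alpha>"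
    using b[of k] Suc.prems by (simp add: \<alpha>_def n_def)
  have hS: "h (Suc k) = h k * (1 - \<alpha> * cnj \<alpha>)"
    by (simp add: h_def \<alpha>_def n_def one_minus_mult_cnj)
  have IH: "\<zeta> * u * \<phi> = cnj \<omega> * \<zeta> ^ k * h k * (q - \<alpha> * (\<zeta> * p))"
      "v * \<phi> = \<zeta> ^ k * h k * (\<zeta> * p - cnj \<alpha> * q)"
    using Suc unfolding Nk poly_opuc_Suc poly_conj_reversed_opuc_Suc u_def v_def \<phi>_def p_def q_def \<alpha>_def
    by auto
  \<comment> \<open>The bracket is the value of \<open>opuc b (Suc k)\<close>, since
    \<open>b (int k) = - \<omega> * cnj \<alpha>\<close>.\<close>
  have "\<zeta> * (\<zeta> * u + cnj \<omega> * \<alpha> * v) * \<phi> = \<zeta> * (\<zeta> * u * \<phi>) + \<zeta> * cnj \<omega> * \<alpha> * (v * \<phi>)"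
    by (simp add: algebra_simps)
  also have "\<dots> = cnj \<omega> * \<zeta> ^ Suc k * h (Suc k) * q"
    unfolding IH hS by (simp add: algebra_simps)
  finally have 1: "\<zeta> * (\<zeta> * u + cnj \<omega> * \<alpha> * v) * \<phi> = cnj \<omega> * \<zeta> ^ Suc k * h (Suc k) * q" .
  have "(v + \<omega> * cnj \<alpha> * (\<zeta> * u)) * \<phi> = v * \<phi> + \<omega> * cnj \<alpha> * (\<zeta> * u * \<phi>)"
    by (simp add: algebra_simps)
  also have "\<dots> = v * \<phi> + (\<omega> * cnj \<omega>) * (cnj \<alpha> * \<zeta> ^ k * h k * (q - \<alpha> * (\<zeta> * p)))"
    unfolding IH(1) by (simp add: algebra_simps)
  also have "\<dots> = \<zeta> ^ Suc k * h (Suc k) * p"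
    unfolding w IH(2) hS by (simp add: algebra_simps)
  finally have 2: "(v + \<omega> * cnj \<alpha> * (\<zeta> * u)) * \<phi> = \<zeta> ^ Suc k * h (Suc k) * p" .
  show ?case
    unfolding n_def[symmetric] poly_opuc_Suc poly_conj_reversed_opuc_Suc bk
      u_def[symmetric] v_def[symmetric] \<phi>_def[symmetric] p_def[symmetric] q_def[symmetric]
    using 1 2 by simp
qed

theorem proposition5p3:
  fixes N :: nat and \<omega> :: complex and a :: "int \<Rightarrow> complex" and z :: "nat \<Rightarrow> complex"
  assumes "N \<ge> 1"
    and "cmod \<omega> = 1"
    and "\<forall>n\<in>{0..int N - 1}. cmod (a n) < 1"
    and "a (int N) = \<omega>"
    and "a (- 1) = - 1"
    and "opuc a (N + 1) = (\<Prod>s\<in>{0..N}. [:- z s, 1:])"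
  shows "(\<forall>n\<in>{0..int N}. a n = - \<omega> * cnj (a (int N - 1 - n))) \<longleftrightarrow>
         (\<forall>s\<in>{0..N}. cmod (poly (opuc a N) (z s)) =
                       sqrt (\<Prod>k<N. 1 - (cmod (a (int k)))\<^sup>2))"
proof -
  define h where "h = (\<Prod>k<N. 1 - (cmod (a (int k)))\<^sup>2)"
  define b where "b = (\<lambda>n. - \<omega> * cnj (a (int N - 1 - n)))"
  have a_less: "cmod (a (int k)) < 1" if "k < N" for k
    using assms(3) that by auto
  have aN: "cmod (a (int N)) = 1" using assms(2,4) by simp
  have w: "\<omega> * cnj \<omega> = 1" using assms(2) by (simp add: complex_norm_square[symmetric])
  have h_pos: "h > 0"
    unfolding h_def by (intro prod_pos) (auto simp: abs_square_less_1 a_less)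
  have fact: "opuc a (Suc N) = [:- z s, 1:] * (\<Prod>t\<in>{0..N} - {s}. [:- z t, 1:])"
    if "s \<le> N" for s
    using assms(6) that by (simp add: prod.remove[of "{0..N}" s] del: opuc.simps)
  \<comment> \<open>The \<open>z s\<close> enter only through the factorisation, so distinctness
    comes from simplicity of the roots.\<close>
  have inj: "inj_on z {0..N}"
  proof (rule inj_onI, rule ccontr)
    fix s t assume st: "s \<in> {0..N}" "t \<in> {0..N}" "z s = z t" "s \<noteq> t"
    then have "poly (\<Prod>t\<in>{0..N} - {s}. [:- z t, 1:]) (z s) = 0"
      by (auto simp: poly_prod)
    then show False
      using simple_root_opuc_Suc[OF aN a_less fact[of s]] st(1) by auto
  qed
  have key: "cmod (poly (opuc a N) (z s)) = sqrt h \<longleftrightarrow> poly (opuc a N) (z s) = poly (opuc b N) (z s)"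
    if s: "s \<le> N" for s
  proof -
    define \<zeta> where "\<zeta> = z s"
    define p where "p = poly (opuc a N) \<zeta>"
    define u where "u = poly (opuc b N) \<zeta>"
    have root: "poly (opuc a (Suc N)) \<zeta> = 0" unfolding fact[OF s] \<zeta>_def by simp
    have \<zeta>: "cmod \<zeta> = 1" using norm_root_opuc_Suc[OF root aN a_less] .
    have root': "\<zeta> * p = cnj \<omega> * poly (conj_reversed (opuc a N)) \<zeta>"
      using root assms(4) unfolding poly_opuc_Suc p_def by simp
    have "(\<Prod>j<N. complex_of_real (1 - (cmod (a (int (N - Suc j))))\<^sup>2)) = of_real h"
      unfolding h_def of_real_prod
      by (rule prod.nat_diff_reindex)
    \<comment> \<open>At \<open>k = N\<close> the remaining reversed polynomial is the constant
      1.\<close>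
    then have up: "\<zeta> * u * p = cnj \<omega> * \<zeta> ^ N * of_real h"
      using reversed_opuc_at_root[of \<omega> N b a \<zeta> N] w root' conj_reversed_opuc_0[of a]
      by (simp add: b_def u_def p_def of_nat_diff algebra_simps)
    have pp: "\<zeta> * p * p = cnj \<omega> * \<zeta> ^ N * of_real ((cmod p)\<^sup>2)"
      unfolding root' poly_conj_reversed_opuc_unit[OF \<zeta>] p_def[symmetric] complex_norm_square
      by (simp add: algebra_simps)
    have nz: "\<zeta> \<noteq> 0" "\<omega> \<noteq> 0" using \<zeta> assms(2) by auto
    \<comment> \<open>The right side of \<open>up\<close> is nonzero because \<open>h > 0\<close>;
      this allows cancelling \<open>p\<close>.\<close>
    then have "p \<noteq> 0" using up h_pos by auto
    then have "p = u \<longleftrightarrow> \<zeta> * p * p = \<zeta> * u * p" using nz by simp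
    also have "\<dots> \<longleftrightarrow> (cmod p)\<^sup>2 = h"
      unfolding up pp using nz by (simp flip: of_real_power)
    also have "\<dots> \<longleftrightarrow> cmod p = sqrt h"
      using h_pos by (metis norm_ge_zero order_less_imp_le real_sqrt_pow2 real_sqrt_unique)
    finally show ?thesis by (simp add: p_def u_def \<zeta>_def)
  qed
  have "(\<forall>s\<in>{0..N}. cmod (poly (opuc a N) (z s)) = sqrt h) \<longleftrightarrow> opuc a N = opuc b N"
  proof
    assume "\<forall>s\<in>{0..N}. cmod (poly (opuc a N) (z s)) = sqrt h"
    then show "opuc a N = opuc b N"
      using card_image[OF inj] key
      by (intro poly_eqI_degree[of "z ` {0..N}"]) (auto simp: degree_opuc)
  qed (use key in auto)
  also have "\<dots> \<longleftrightarrow> (\<forall>k<N. a (int k) = b (int k))"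
    using opuc_inj[of a N b] a_less opuc_cong[of N a b] by blast
  also have "\<dots> \<longleftrightarrow> (\<forall>n\<in>{0..int N}. a n = b n)"
  proof
    assume *: "\<forall>k<N. a (int k) = b (int k)"
    show "\<forall>n\<in>{0..int N}. a n = b n"
    proof
      fix n assume n: "n \<in> {0..int N}"
      then have "n = int (nat n)" "nat n < N \<or> n = int N" by auto
      \<comment> \<open>\<open>opuc a N\<close> sees only indices below \<open>N\<close>. At
        \<open>N\<close> the reflected index is -1, and \<open>a (- 1) = - 1\<close> gives
        \<open>b (int N) = \<omega>\<close>.\<close>
      moreover have "a (int N) = b (int N)" using assms(4,5) by (simp add: b_def)
      ultimately show "a n = b n" using * by metis
    qed
  qed auto
  finally show ?thesis by (simp add: b_def h_def)
qed

end
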